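(* Let $F=\frac1n\sum_{i=1}^nf_i$ where each $f_i$ is differentiable, possibly non-convex and $L$-smooth on $\Omega$, let $\theta_0\in\Omega$, and let $\theta^\star$ be a minimizer of $F$ over $\Omega$. Run the NCGS-VR algorithm (defined in the context) from $\theta_0$ with $b=n^{2/3}$, $m=n^{1/3}$ (with $n^{1/3}$ an integer), $\lambda_t=\lambda=\frac{1}{3L}$, $T$ a positive multiple of $m$, and $\eta_t=\eta=\frac1T$. Then the output $\theta_\alpha$ satisfies $$\mathbb{E}\big[\|g(\theta_\alpha,\nabla F(\theta_\alpha),\lambda)\|^2\big]\le\frac{18L\,\big(F(\theta_0)-F(\theta^\star)+1\big)}{T}.$$
   Context: Setting: $\Omega\subset\mathbb{R}^d$ is nonempty, compact and convex; the problem is $\min_{\theta\in\Omega}F(\theta)$; norms are Euclidean. A function $f$ is $L$-smooth ($L>0$) on $\Omega$ if $\|\nabla f(\theta_1)-\nabla f(\theta_2)\|\le L\|\theta_1-\theta_2\|$ for all $\theta_1,\theta_2\in\Omega$. For $x,\omega\in\mathbb{R}^d$ and $\gamma>0$: $\psi(x,\omega,\gamma)=\arg\min_{\theta\in\Omega}\langle\omega,\theta\rangle+\frac{1}{2\gamma}\|\theta-x\|^2$, and the gradient mapping is $g(x,\omega,\gamma)=\frac1\gamma\big(x-\psi(x,\omega,\gamma)\big)$. Procedure $u^+=condg(w,u,\lambda,\eta)$, for $w\in\mathbb{R}^d$, $u\in\Omega$, $\lambda,\eta>0$: set $u_1=u$. For $t=1,2,\dots$: let $v_t\in\Omega$ attain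 $V(u_t)=\max_{x\in\Omega}\langle w+\frac1\lambda(u_t-u),u_t-x\rangle$; if $V(u_t)\le\eta$, return $u^+=u_t$ and stop; otherwise set $u_{t+1}=(1-\xi_t)u_t+\xi_tv_t$ with $\xi_t=\min\Big\{1,\frac{\langle\frac1\lambda(u-u_t)-w,\,v_t-u_t\rangle}{\frac1\lambda\|v_t-u_t\|^2}\Big\}$. NCGS-VR algorithm with epoch length $m$, step size $\lambda$, tolerance $\eta$, minibatch size $b$, iteration limit $T$, $S=T/m$: set $\tilde\theta^0=\theta_m^0=\theta_0$. For $s=0,\dots,S-1$: set $\theta_0^{s+1}=\theta_m^s$ and $g^{s+1}=\frac1n\sum_{i=1}^n\nabla f_i(\tilde\theta^s)$; for $t=0,\dots,m-1$: draw a multiset $I_t$ of $b$ indices independently and uniformly from $\{1,\dots,n\}$ with replacement (independently of the past), set $v_t^{s+1}=\frac1b\sum_{i\in I_t}\big(\nabla f_i(\theta_t^{s+1})-\nabla f_i(\tilde\theta^s)\big)+g^{s+1}$ and $\theta_{t+1}^{s+1}=condg(v_t^{s+1},\theta_t^{s+1},\lambda,\eta)$; then set $\tilde\theta^{s+1}=\theta_m^{s+1}$. Output $\theta_\alpha$ chosen uniformly at random (independently of everything else) from $\{\theta_t^{s+1}:0\le t\le m-1,\ 0\le s\le S-1\}$. The expectation is over all index draws and the choice of output. *)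

theory Defs
  imports "HOL-Probability.Probability"
begin

definition gradient :: "('a::real_inner \<Rightarrow> real) \<Rightarrow> 'a \<Rightarrow> 'a" where
  "gradient f x = (THE D. GDERIV f x :> D)"

definition L_smooth_on :: "real \<Rightarrow> 'a::real_inner set \<Rightarrow> ('a \<Rightarrow> real) \<Rightarrow> bool" where
  "L_smooth_on L \<Omega> f \<longleftrightarrow> L > 0 \<and>
     (\<forall>x\<in>\<Omega>. \<forall>y\<in>\<Omega>. norm (gradient f x - gradient f y) \<le> L * norm (x - y))"

definition avg_fun :: "nat \<Rightarrow> (nat \<Rightarrow> 'a \<Rightarrow> real) \<Rightarrow> 'a \<Rightarrow> real" where
  "avg_fun n f x = (1 / real n) * (\<Sum>i=1..n. f i x)"

definition prox_point :: "'a::real_inner set \<Rightarrow> 'a \<Rightarrow> 'a \<Rightarrow> real \<Rightarrow> 'a" where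
  "prox_point \<Omega> x w \<gamma> = arg_min_on (\<lambda>\<theta>. w \<bullet> \<theta> + (1 / (2 * \<gamma>)) * (norm (\<theta> - x))\<^sup>2) \<Omega>"

definition gradient_mapping :: "'a::real_inner set \<Rightarrow> 'a \<Rightarrow> 'a \<Rightarrow> real \<Rightarrow> 'a" where
  "gradient_mapping \<Omega> x w \<gamma> = (1 / \<gamma>) *\<^sub>R (x - prox_point \<Omega> x w \<gamma>)"

definition cg_gap :: "'a::real_inner set \<Rightarrow> 'a \<Rightarrow> 'a \<Rightarrow> real \<Rightarrow> 'a \<Rightarrow> real" where
  "cg_gap \<Omega> w u lam z = (SUP x\<in>\<Omega>. (w + (1 / lam) *\<^sub>R (z - u)) \<bullet> (z - x))"

definition cg_stepsize :: "'a::real_inner \<Rightarrow> 'a \<Rightarrow> real \<Rightarrow> 'a \<Rightarrow> 'a \<Rightarrow> real" where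
  "cg_stepsize w u lam z v =
     min 1 ((((1 / lam) *\<^sub>R (u - z) - w) \<bullet> (v - z)) / ((1 / lam) * (norm (v - z))\<^sup>2))"

text \<open>
  The maximizer chosen in each conditional gradient step need not be unique, so the procedure
  is a relation between its input and its possible outputs \<open>u'\<close>. That some gap is at most
  \<open>\<eta>\<close> is not part of the definition: if this never happened, the \<open>LEAST\<close>
  operator would yield an unspecified index.
\<close>

definition condg :: "'a::real_inner set \<Rightarrow> 'a \<Rightarrow> 'a \<Rightarrow> real \<Rightarrow> real \<Rightarrow> 'a \<Rightarrow> bool" where
  "condg \<Omega> w u lam \<eta> u' \<longleftrightarrow>
     (\<exists>U v. U (1::nat) = u \<and>
        (\<forall>t\<ge>1. \<not> cg_gap \<Omega> w u lam (U t) \<le> \<eta> \<longrightarrow>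
           v t \<in> \<Omega> \<and>
           (w + (1 / lam) *\<^sub>R (U t - u)) \<bullet> (U t - v t) = cg_gap \<Omega> w u lam (U t) \<and>
           U (t + 1) = (1 - cg_stepsize w u lam (U t) (v t)) *\<^sub>R U t
                         + cg_stepsize w u lam (U t) (v t) *\<^sub>R v t) \<and>
        u' = U (LEAST t. t \<ge> 1 \<and> cg_gap \<Omega> w u lam (U t) \<le> \<eta>))"

text \<open>
  A table \<open>\<omega>\<close> of index draws has \<open>\<omega> (s, t, k)\<close> as the \<open>k\<close>-th of the \<open>b\<close> indices
  drawn in step \<open>t\<close> of epoch \<open>s\<close>; all entries are independent and uniform on
  \<open>{1..n}\<close>, and the entries outside the index range have the dummy value 0.
\<close>

definition index_draws :: "nat \<Rightarrow> nat \<Rightarrow> nat \<Rightarrow> nat \<Rightarrow> (nat \<times> nat \<times> nat \<Rightarrow> nat) pmf" where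
  "index_draws n S m b =
     Pi_pmf ({..<S} \<times> {..<m} \<times> {..<b}) 0 (\<lambda>_. pmf_of_set {1..n})"

definition svrg_direction ::
  "(nat \<Rightarrow> 'a::real_inner \<Rightarrow> real) \<Rightarrow> nat \<Rightarrow> nat \<Rightarrow> (nat \<Rightarrow> nat) \<Rightarrow> 'a \<Rightarrow> 'a \<Rightarrow> 'a" where
  "svrg_direction f n b I x snap =
     (1 / real b) *\<^sub>R (\<Sum>k<b. gradient (f (I k)) x - gradient (f (I k)) snap)
     + (1 / real n) *\<^sub>R (\<Sum>i=1..n. gradient (f i) snap)"

text \<open>
  \<open>\<theta> \<omega> e t\<close> is the iterate with epoch superscript \<open>e\<close> and step subscript \<open>t\<close> when the
  index draws are \<open>\<omega>\<close>. The snapshot of epoch \<open>s\<close> is \<open>\<theta> \<omega> s m\<close>, which for \<open>s = 0\<close> is the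
  starting point. The last conjunct says that an iterate, and hence the choice among several
  maximizers made in the conditional gradient steps leading to it, is determined by the draws
  made so far; it is what makes each minibatch independent of the past.
\<close>

definition ncgs_vr ::
  "'a::real_inner set \<Rightarrow> (nat \<Rightarrow> 'a \<Rightarrow> real) \<Rightarrow> nat \<Rightarrow> nat \<Rightarrow> real \<Rightarrow> real \<Rightarrow> nat \<Rightarrow> nat \<Rightarrow> 'a \<Rightarrow>
     ((nat \<times> nat \<times> nat \<Rightarrow> nat) \<Rightarrow> nat \<Rightarrow> nat \<Rightarrow> 'a) \<Rightarrow> bool" where
  "ncgs_vr \<Omega> f n m lam \<eta> b T \<theta>\<^sub>0 \<theta> \<longleftrightarrow>
     (let S = T div m; D = set_pmf (index_draws n S m b) in
       (\<forall>\<omega>\<in>D. \<theta> \<omega> 0 m = \<theta>\<^sub>0) \<and>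
       (\<forall>\<omega>\<in>D. \<forall>s<S. \<theta> \<omega> (s + 1) 0 = \<theta> \<omega> s m) \<and>
       (\<forall>\<omega>\<in>D. \<forall>s<S. \<forall>t<m.
          condg \<Omega>
            (svrg_direction f n b (\<lambda>k. \<omega> (s, t, k)) (\<theta> \<omega> (s + 1) t) (\<theta> \<omega> s m))
            (\<theta> \<omega> (s + 1) t) lam \<eta> (\<theta> \<omega> (s + 1) (t + 1))) \<and>
       (\<forall>\<omega>\<in>D. \<forall>\<omega>'\<in>D. \<forall>s<S. \<forall>t\<le>m.
          (\<forall>s' t' k. s' < s \<or> s' = s \<and> t' < t \<longrightarrow> \<omega> (s', t', k) = \<omega>' (s', t', k)) \<longrightarrow>
          \<theta> \<omega> (s + 1) t = \<theta> \<omega>' (s + 1) t))"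

definition ncgs_vr_output ::
  "nat \<Rightarrow> nat \<Rightarrow> nat \<Rightarrow> nat \<Rightarrow> ((nat \<times> nat \<times> nat \<Rightarrow> nat) \<Rightarrow> nat \<Rightarrow> nat \<Rightarrow> 'a) \<Rightarrow> 'a pmf" where
  "ncgs_vr_output n m b T \<theta> =
     map_pmf (\<lambda>(\<omega>, (s, t)). \<theta> \<omega> (s + 1) t)
       (pair_pmf (index_draws n (T div m) m b) (pmf_of_set ({..<T div m} \<times> {..<m})))"

end

theory Submission imports Defs begin

text \<open>
  Write \<open>x\<close>, \<open>y\<close> for consecutive iterates, \<open>p\<close> for the exact proximal point of \<open>x\<close> with respect to
  \<open>\<nabla>F(x)\<close> and \<open>e\<close> for the error of the stochastic gradient. Adding the descent lemma, the variational
  inequality of \<open>p\<close> tested at \<open>x\<close> and the approximate one of \<open>y\<close> tested at \<open>p\<close>, and absorbing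
  \<open>\<langle>e, y - p\<rangle>\<close> by Young's inequality, gives for \<open>lam = 1 / (3 L)\<close>
  \<open>F(y) \<le> F(x) + \<eta> - L |y - x|\<^sup>2 - (L / 2) |p - x|\<^sup>2 + |e|\<^sup>2 / (6 L)\<close>.
  Independence of the minibatch bounds the expectation of \<open>|e|\<^sup>2\<close> by \<open>L\<^sup>2 / b\<close> times that of the squared
  distance to the snapshot, which is at most \<open>m\<close> times the sum of the squared step lengths of the
  epoch. Since \<open>b = m\<^sup>2\<close>, the errors of an epoch are absorbed by the terms \<open>- L |y - x|\<^sup>2\<close>, without
  any Lyapunov function, and the rest telescopes.
\<close>

section \<open>Gradients and the descent lemma\<close>

lemma GDERIV_gradient:
  assumes "GDERIV f x :> D"
  shows "gradient f x = D"
  unfolding gradient_def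
proof (rule the_equality)
  fix D' assume "GDERIV f x :> D'"
  with assms have "(\<lambda>h. h \<bullet> D') = (\<lambda>h. h \<bullet> D)"
    by (auto simp: gderiv_def intro: has_derivative_unique)
  then have "\<forall>h. h \<bullet> D' = h \<bullet> D" by meson
  then show "D' = D" by (simp only: vector_eq_ldot)
qed (fact assms)

text \<open>The vector whose coordinates are the values of the derivative on \<open>Basis\<close>
  represents that derivative, so the definite description \<open>gradient\<close> has a witness; its
  uniqueness is \<open>GDERIV_gradient\<close>.\<close>

lemma differentiable_GDERIV_gradient:
  fixes f :: "'a::euclidean_space \<Rightarrow> real"
  assumes "f differentiable (at x)"
  shows "GDERIV f x :> gradient f x"
proof -
  obtain f' where f': "(f has_derivative f') (at x)"
    using assms by (auto simp: differentiable_def)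
  interpret linear f' using f' by (rule has_derivative_linear)
  have "f' h = h \<bullet> (\<Sum>b\<in>Basis. f' b *\<^sub>R b)" for h
    using euclidean_representation[of h] sum[of "\<lambda>b. (h \<bullet> b) *\<^sub>R b" Basis]
    by (simp add: scale inner_sum_right mult.commute)
  then have "f' = (\<lambda>h. h \<bullet> (\<Sum>b\<in>Basis. f' b *\<^sub>R b))" by (rule ext)
  then have "GDERIV f x :> (\<Sum>b\<in>Basis. f' b *\<^sub>R b)"
    using f' unfolding gderiv_def by metis
  then show ?thesis using GDERIV_gradient by metis
qed

lemma GDERIV_sum:
  "(\<And>i. i \<in> A \<Longrightarrow> GDERIV (f i) x :> D i) \<Longrightarrow> GDERIV (\<lambda>x. \<Sum>i\<in>A. f i x) x :> (\<Sum>i\<in>A. D i)"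
  unfolding gderiv_def inner_sum_right by (rule has_derivative_sum)

lemma GDERIV_mult_left:
  "GDERIV f x :> D \<Longrightarrow> GDERIV (\<lambda>x. c * f x) x :> c *\<^sub>R D"
  unfolding gderiv_def inner_scaleR_right by (rule has_derivative_mult_right)

lemma GDERIV_avg_fun:
  fixes f :: "nat \<Rightarrow> 'a::euclidean_space \<Rightarrow> real"
  assumes "\<And>i. i \<in> {1..n} \<Longrightarrow> f i differentiable (at x)"
  shows "GDERIV (avg_fun n f) x :> (1 / real n) *\<^sub>R (\<Sum>i=1..n. gradient (f i) x)"
  unfolding avg_fun_def
  by (intro GDERIV_mult_left GDERIV_sum differentiable_GDERIV_gradient assms)

text \<open>Subtracting the linear and quadratic terms from \<open>f\<close> along the segment
  leaves \<open>\<phi>\<close>, whose derivative is nonpositive by Cauchy-Schwarz and the Lipschitz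
  bound against the base point \<open>x\<close> alone. A monotonicity argument thus replaces
  integration of the gradient.\<close>

lemma descent_upper:
  fixes f :: "'a::euclidean_space \<Rightarrow> real"
  assumes "convex \<Omega>" and "x \<in> \<Omega>" and "y \<in> \<Omega>"
    and deriv: "\<And>z. z \<in> \<Omega> \<Longrightarrow> GDERIV f z :> D z"
    and lip: "\<And>z. z \<in> \<Omega> \<Longrightarrow> norm (D z - D x) \<le> L * norm (z - x)"
  shows "f y \<le> f x + D x \<bullet> (y - x) + (L / 2) * (norm (y - x))\<^sup>2"
proof -
  define d where "d = y - x"
  define \<phi> where "\<phi> t = f (x + t *\<^sub>R d) - t * (D x \<bullet> d) - (L / 2) * t\<^sup>2 * (norm d)\<^sup>2" for t
  have "\<phi> 1 \<le> \<phi> 0"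
  proof (rule DERIV_nonpos_imp_nonincreasing[where f = \<phi>])
    fix t :: real assume t: "0 \<le> t" "t \<le> 1"
    have in\<Omega>: "x + t *\<^sub>R d \<in> \<Omega>"
    proof -
      have "(1 - t) *\<^sub>R x + t *\<^sub>R y \<in> \<Omega>" using assms(1-3) t by (simp add: convexD)
      then show ?thesis by (simp add: d_def algebra_simps)
    qed
    have "((\<lambda>t. x + t *\<^sub>R d) has_derivative (\<lambda>h. h *\<^sub>R d)) (at t)"
      by (auto intro!: derivative_eq_intros)
    then have "((\<lambda>t. f (x + t *\<^sub>R d)) has_derivative (\<lambda>h. (h *\<^sub>R d) \<bullet> D (x + t *\<^sub>R d))) (at t)"
      using deriv[OF in\<Omega>] unfolding gderiv_def by (rule has_derivative_compose)
    then have "((\<lambda>t. f (x + t *\<^sub>R d)) has_real_derivative (D (x + t *\<^sub>R d) \<bullet> d)) (at t)"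
      by (simp add: has_field_derivative_def inner_commute mult_commute_abs)
    then have "(\<phi> has_real_derivative ((D (x + t *\<^sub>R d) - D x) \<bullet> d - L * t * (norm d)\<^sup>2)) (at t)"
      unfolding \<phi>_def by (auto intro!: derivative_eq_intros simp: inner_diff_left)
    moreover have "(D (x + t *\<^sub>R d) - D x) \<bullet> d \<le> L * t * (norm d)\<^sup>2"
    proof -
      have "(D (x + t *\<^sub>R d) - D x) \<bullet> d \<le> norm (D (x + t *\<^sub>R d) - D x) * norm d"
        by (rule norm_cauchy_schwarz)
      also have "\<dots> \<le> (L * norm ((x + t *\<^sub>R d) - x)) * norm d"
        by (intro mult_right_mono lip in\<Omega>) simp
      also have "\<dots> = L * t * (norm d)\<^sup>2" using t by (simp add: power2_eq_square)
      finally show ?thesis .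
    qed
    ultimately show "\<exists>y. (\<phi> has_real_derivative y) (at t) \<and> y \<le> 0" by force
  qed simp
  then show ?thesis by (simp add: \<phi>_def d_def)
qed

section \<open>Exact proximal points\<close>

text \<open>Completing the square turns the proximal problem into the projection of
  \<open>x - \<gamma> *\<^sub>R w\<close> onto \<open>\<Omega>\<close>. The variational inequality
  is the obtuse angle criterion for that projection, divided by \<open>\<gamma>\<close>.\<close>

lemma prox_point_properties:
  fixes x w :: "'a::euclidean_space"
  assumes "\<Omega> \<noteq> {}" and "compact \<Omega>" and "convex \<Omega>" and "\<gamma> > 0"
  shows prox_point_in: "prox_point \<Omega> x w \<gamma> \<in> \<Omega>"
    and prox_point_variational:
      "z \<in> \<Omega> \<Longrightarrow> (w + (1 / \<gamma>) *\<^sub>R (prox_point \<Omega> x w \<gamma> - x)) \<bullet> (prox_point \<Omega> x w \<gamma> - z) \<le> 0"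
proof -
  define h where "h \<theta> = w \<bullet> \<theta> + (1 / (2 * \<gamma>)) * (norm (\<theta> - x))\<^sup>2" for \<theta>
  define p where "p = prox_point \<Omega> x w \<gamma>"
  have "continuous_on \<Omega> h" unfolding h_def by (intro continuous_intros)
  then obtain q where "q \<in> \<Omega>" "\<And>z. z \<in> \<Omega> \<Longrightarrow> h q \<le> h z"
    using continuous_attains_inf assms(1,2) by metis
  \<comment> \<open>\<open>arg_min_on\<close> is a choice operator and is known to yield a minimizer
    only once one exists; compactness supplies \<open>q\<close>.\<close>
  then have "is_arg_min h (\<lambda>z. z \<in> \<Omega>) q" by (auto simp: is_arg_min_linorder)
  then have "is_arg_min h (\<lambda>z. z \<in> \<Omega>) p"
    unfolding p_def prox_point_def arg_min_on_def arg_min_def h_def by (rule someI)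
  then have p: "p \<in> \<Omega>" and pmin: "\<And>z. z \<in> \<Omega> \<Longrightarrow> h p \<le> h z" by (auto simp: is_arg_min_linorder)
  show "prox_point \<Omega> x w \<gamma> \<in> \<Omega>" using p by (simp add: p_def)
  assume z: "z \<in> \<Omega>"
  have complete_square: "(dist (x - \<gamma> *\<^sub>R w) y)\<^sup>2 = 2 * \<gamma> * (h y - w \<bullet> x) + \<gamma>\<^sup>2 * (w \<bullet> w)" for y
  proof -
    have "2 * \<gamma> * h y = 2 * \<gamma> * (w \<bullet> y) + (norm (y - x))\<^sup>2"
      using \<open>\<gamma> > 0\<close> by (simp add: h_def field_simps)
    then show ?thesis
      unfolding dist_norm power2_norm_eq_inner
      by (simp add: inner_diff_left inner_diff_right inner_commute algebra_simps power2_eq_square)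
  qed
  have "(dist (x - \<gamma> *\<^sub>R w) p)\<^sup>2 \<le> (dist (x - \<gamma> *\<^sub>R w) y)\<^sup>2" if "y \<in> \<Omega>" for y
    using pmin[OF that] \<open>\<gamma> > 0\<close> by (simp add: complete_square)
  then have "\<forall>y\<in>\<Omega>. dist (x - \<gamma> *\<^sub>R w) p \<le> dist (x - \<gamma> *\<^sub>R w) y"
    by (meson power2_le_imp_le zero_le_dist)
  then have "(x - \<gamma> *\<^sub>R w - p) \<bullet> (z - p) \<le> 0"
    using any_closest_point_dot[OF \<open>convex \<Omega>\<close> compact_imp_closed[OF \<open>compact \<Omega>\<close>] p z] by blast
  moreover have "(x - \<gamma> *\<^sub>R w - p) \<bullet> (z - p) = \<gamma> * ((w + (1 / \<gamma>) *\<^sub>R (p - x)) \<bullet> (p - z))"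
    using \<open>\<gamma> > 0\<close> by (simp add: inner_diff_left inner_diff_right inner_add_left field_simps)
  ultimately show "(w + (1 / \<gamma>) *\<^sub>R (prox_point \<Omega> x w \<gamma> - x)) \<bullet> (prox_point \<Omega> x w \<gamma> - z) \<le> 0"
    using \<open>\<gamma> > 0\<close> by (simp add: p_def mult_le_0_iff)
qed

section \<open>The conditional gradient procedure\<close>

text \<open>A real \<open>SUP\<close> is sure to bound its family only if the family is bounded
  above, which follows from compactness.\<close>

lemma cg_gap_upper:
  fixes w :: "'a::euclidean_space"
  assumes "compact \<Omega>" and "x \<in> \<Omega>"
  shows "(w + (1 / lam) *\<^sub>R (z - u)) \<bullet> (z - x) \<le> cg_gap \<Omega> w u lam z"
  unfolding cg_gap_def
proof (rule cSUP_upper)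
  have "compact ((\<lambda>x. (w + (1 / lam) *\<^sub>R (z - u)) \<bullet> (z - x)) ` \<Omega>)"
    by (intro compact_continuous_image continuous_intros assms)
  then show "bdd_above ((\<lambda>x. (w + (1 / lam) *\<^sub>R (z - u)) \<bullet> (z - x)) ` \<Omega>)"
    by (intro bounded_imp_bdd_above compact_imp_bounded)
qed (fact assms)

text \<open>Along the segment from \<open>z\<close> to \<open>v\<close> the function
  \<open>q\<close> is a parabola with initial slope \<open>- g\<close>, and \<open>\<xi>\<close> is
  its minimizer on [0, 1]. Working with a bound \<open>B\<close> on the squared length makes the
  guaranteed decrease the same for every \<open>z\<close>.\<close>

lemma cg_step_decrease:
  fixes w u z v :: "'a::real_inner" and lam \<eta> B :: real
  defines "q \<equiv> \<lambda>z. w \<bullet> z + (1 / (2 * lam)) * (norm (z - u))\<^sup>2"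
    and "\<xi> \<equiv> cg_stepsize w u lam z v"
    and "g \<equiv> (w + (1 / lam) *\<^sub>R (z - u)) \<bullet> (z - v)"
  assumes lam: "lam > 0" and gt: "g > \<eta>" and \<eta>: "\<eta> > 0" and le_B: "(norm (v - z))\<^sup>2 \<le> B"
  shows cg_stepsize_bounds: "0 \<le> \<xi>" "\<xi> \<le> 1"
    and "q ((1 - \<xi>) *\<^sub>R z + \<xi> *\<^sub>R v) \<le> q z - min 1 (\<eta> * lam / B) * \<eta> / 2"
proof -
  define N where "N = (norm (v - z))\<^sup>2"
  have "z \<noteq> v" using gt \<eta> by (auto simp: g_def)
  then have N: "N > 0" by (simp add: N_def)
  have B: "B > 0" using N le_B unfolding N_def by linarith
  have g: "((1 / lam) *\<^sub>R (u - z) - w) \<bullet> (v - z) = g"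
    by (simp add: g_def algebra_simps inner_diff_left inner_diff_right inner_add_left)
  have \<xi>: "\<xi> = min 1 (g * lam / N)"
    unfolding \<xi>_def cg_stepsize_def g N_def by simp
  show "0 \<le> \<xi>" "\<xi> \<le> 1" using \<xi> N lam gt \<eta> by auto
  \<comment> \<open>This holds in both branches of \<open>min\<close>. It caps the quadratic term at
    half of the linear gain, so at least \<open>\<xi> * g / 2\<close> of the decrease
    remains.\<close>
  have "\<xi> * N \<le> g * lam" using N by (simp add: \<xi> min_def field_simps)
  then have le_g: "\<xi> * (\<xi> * N / lam) \<le> \<xi> * g"
    using \<open>0 \<le> \<xi>\<close> lam by (intro mult_left_mono) (simp add: field_simps)
  have expand: "q ((1 - \<xi>) *\<^sub>R z + \<xi> *\<^sub>R v) = q z - \<xi> * g + \<xi> * (\<xi> * N / lam) / 2"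
  proof -
    define a d where "a = z - u" and "d = v - z"
    have move: "(1 - \<xi>) *\<^sub>R z + \<xi> *\<^sub>R v = z + \<xi> *\<^sub>R d" "z + \<xi> *\<^sub>R d - u = a + \<xi> *\<^sub>R d"
      by (simp_all add: a_def d_def algebra_simps)
    have square: "(norm (a + \<xi> *\<^sub>R d))\<^sup>2 = (norm a)\<^sup>2 + 2 * \<xi> * (a \<bullet> d) + \<xi>\<^sup>2 * N"
      unfolding N_def d_def[symmetric] power2_norm_eq_inner
      by (simp add: inner_add_left inner_add_right inner_commute power2_eq_square)
    have g_split: "g = - (w \<bullet> d) - (a \<bullet> d) / lam"
      by (simp add: g_def a_def d_def inner_add_left inner_diff_left inner_diff_right diff_divide_distrib)
    show ?thesis
      unfolding q_def move square a_def[symmetric] g_split using lam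
      by (simp add: inner_add_right field_simps power2_eq_square)
  qed
  have "\<eta> * lam / B \<le> g * lam / N"
    using lam gt \<eta> le_B N by (intro frac_le mult_right_mono) (auto simp: N_def)
  then have "min 1 (\<eta> * lam / B) \<le> \<xi>" unfolding \<xi> by linarith
  moreover have "min 1 (\<eta> * lam / B) \<ge> 0" using lam \<eta> B by simp
  ultimately have "min 1 (\<eta> * lam / B) * \<eta> \<le> \<xi> * g"
    using gt \<eta> \<open>0 \<le> \<xi>\<close> by (intro mult_mono) auto
  then show "q ((1 - \<xi>) *\<^sub>R z + \<xi> *\<^sub>R v) \<le> q z - min 1 (\<eta> * lam / B) * \<eta> / 2"
    using expand le_g by argo
qed

text \<open>
  Every step taken with gap above \<open>\<eta>\<close> decreases the quadratic by a fixed amount, so the procedure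
  terminates and the \<open>LEAST\<close> index in the definition of \<open>condg\<close> is meaningful.
\<close>

lemma condg_spec:
  fixes w u :: "'a::euclidean_space"
  assumes "compact \<Omega>" and "convex \<Omega>" and "u \<in> \<Omega>" and "lam > 0" and "\<eta> > 0"
    and "condg \<Omega> w u lam \<eta> u'"
  shows condg_in: "u' \<in> \<Omega>"
    and condg_gap: "x \<in> \<Omega> \<Longrightarrow> (w + (1 / lam) *\<^sub>R (u' - u)) \<bullet> (u' - x) \<le> \<eta>"
proof -
  obtain U v where U1: "U (1::nat) = u"
    and step: "\<And>t. t \<ge> 1 \<Longrightarrow> \<not> cg_gap \<Omega> w u lam (U t) \<le> \<eta> \<Longrightarrow>
           v t \<in> \<Omega> \<and>
           (w + (1 / lam) *\<^sub>R (U t - u)) \<bullet> (U t - v t) = cg_gap \<Omega> w u lam (U t) \<and>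
           U (t + 1) = (1 - cg_stepsize w u lam (U t) (v t)) *\<^sub>R U t
                         + cg_stepsize w u lam (U t) (v t) *\<^sub>R v t"
    and u': "u' = U (LEAST t. t \<ge> 1 \<and> cg_gap \<Omega> w u lam (U t) \<le> \<eta>)"
    using assms(6) unfolding condg_def by blast
  define q where "q z = w \<bullet> z + (1 / (2 * lam)) * (norm (z - u))\<^sup>2" for z
  obtain D where D: "\<And>x y. x \<in> \<Omega> \<Longrightarrow> y \<in> \<Omega> \<Longrightarrow> norm (x - y) \<le> D"
    using compact_imp_bounded[OF assms(1)] by (metis bounded_two_points dist_norm)
  \<comment> \<open>The \<open>+ 1\<close> keeps the denominator positive if \<open>D\<close> is 0,
    which a singleton \<open>\<Omega>\<close> permits; division by 0 would make
    \<open>\<delta>\<close> vanish.\<close>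
  define \<delta> where "\<delta> = min 1 (\<eta> * lam / (D\<^sup>2 + 1)) * \<eta> / 2"
  have "\<delta> > 0" using assms(4,5) by (simp add: \<delta>_def add_nonneg_pos)
  \<comment> \<open>The indices of \<open>U\<close> start at 1, so \<open>U (Suc k)\<close> is the
    point after \<open>k\<close> steps.\<close>
  have run: "U (Suc k) \<in> \<Omega> \<and> q (U (Suc k)) \<le> q u - real k * \<delta>"
    if "\<And>t. 1 \<le> t \<Longrightarrow> t \<le> k \<Longrightarrow> \<not> cg_gap \<Omega> w u lam (U t) \<le> \<eta>" for k
    using that
  proof (induction k)
    case 0
    then show ?case using assms(3) U1 by simp
  next
    case (Suc k)
    then have IH: "U (Suc k) \<in> \<Omega>" "q (U (Suc k)) \<le> q u - real k * \<delta>" by auto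
    have gap: "\<not> cg_gap \<Omega> w u lam (U (Suc k)) \<le> \<eta>" using Suc.prems by simp
    note s = step[OF _ gap, simplified]
    define \<xi> where "\<xi> = cg_stepsize w u lam (U (Suc k)) (v (Suc k))"
    have dec: "(w + (1 / lam) *\<^sub>R (U (Suc k) - u)) \<bullet> (U (Suc k) - v (Suc k)) > \<eta>"
      using s gap by simp
    have "norm (v (Suc k) - U (Suc k)) \<le> D" using D IH(1) s by blast
    then have nB: "(norm (v (Suc k) - U (Suc k)))\<^sup>2 \<le> D\<^sup>2 + 1"
      by (smt (verit) norm_ge_zero power_mono)
    have \<xi>01: "0 \<le> \<xi>" "\<xi> \<le> 1"
      using cg_stepsize_bounds[OF assms(4) dec assms(5) nB] by (simp_all add: \<xi>_def)
    have next_U: "U (Suc (Suc k)) = (1 - \<xi>) *\<^sub>R U (Suc k) + \<xi> *\<^sub>R v (Suc k)"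
      using s by (simp add: \<xi>_def)
    have "U (Suc (Suc k)) \<in> \<Omega>"
      unfolding next_U using IH(1) s \<xi>01 assms(2) by (auto intro!: convexD)
    moreover have "q (U (Suc (Suc k))) \<le> q (U (Suc k)) - \<delta>"
      unfolding next_U q_def \<delta>_def \<xi>_def by (rule cg_step_decrease(3)[OF assms(4) dec assms(5) nB])
    ultimately show ?case using IH(2) by (simp add: algebra_simps)
  qed
  \<comment> \<open>On a compact set \<open>q\<close> is bounded below, so a decrease linear in the
    number of steps cannot last.\<close>
  have terminates: "\<exists>t\<ge>1. cg_gap \<Omega> w u lam (U t) \<le> \<eta>"
  proof (rule ccontr)
    assume "\<not> ?thesis"
    then have decr: "U (Suc k) \<in> \<Omega> \<and> q (U (Suc k)) \<le> q u - real k * \<delta>" for k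
      using run by blast
    have "continuous_on \<Omega> q" unfolding q_def by (intro continuous_intros)
    then obtain z where "\<And>x. x \<in> \<Omega> \<Longrightarrow> q z \<le> q x"
      using continuous_attains_inf assms(1,3) by (metis empty_iff)
    then have "real k * \<delta> \<le> q u - q z" for k using decr[of k] by force
    moreover obtain k :: nat where "q u - q z < real k * \<delta>"
      using \<open>\<delta> > 0\<close> reals_Archimedean3 by blast
    ultimately show False by (meson not_less)
  qed
  define t where "t = (LEAST t. t \<ge> 1 \<and> cg_gap \<Omega> w u lam (U t) \<le> \<eta>)"
  have t: "t \<ge> 1" "cg_gap \<Omega> w u lam (U t) \<le> \<eta>"
    using LeastI_ex[OF terminates] by (auto simp: t_def)
  \<comment> \<open>All gaps before the least index exceed \<open>\<eta>\<close>, so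
    \<open>run\<close> with \<open>k = t - 1\<close> places \<open>U t\<close> in
    \<open>\<Omega>\<close>.\<close>
  have "\<not> cg_gap \<Omega> w u lam (U r) \<le> \<eta>" if "1 \<le> r" "r \<le> t - 1" for r
    using not_less_Least[of r "\<lambda>t. t \<ge> 1 \<and> cg_gap \<Omega> w u lam (U t) \<le> \<eta>"] that t(1)
    unfolding t_def[symmetric] by auto
  then show "u' \<in> \<Omega>" using run[of "t - 1"] t(1) unfolding u' t_def[symmetric] by simp
  show "(w + (1 / lam) *\<^sub>R (u' - u)) \<bullet> (u' - x) \<le> \<eta>" if "x \<in> \<Omega>"
    using cg_gap_upper[OF assms(1) that, of w lam u' u] t(2) unfolding u' t_def[symmetric] by linarith
qed

section \<open>One inexact proximal step\<close>

lemma inexact_prox_descent: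
  fixes F :: "'a::euclidean_space \<Rightarrow> real"
  assumes "\<Omega> \<noteq> {}" and "compact \<Omega>" and "convex \<Omega>" and "L > 0"
    and "\<And>z. z \<in> \<Omega> \<Longrightarrow> GDERIV F z :> D z"
    and "\<And>y z. y \<in> \<Omega> \<Longrightarrow> z \<in> \<Omega> \<Longrightarrow> norm (D y - D z) \<le> L * norm (y - z)"
    and "lam = 1 / (3 * L)"
    and x: "x \<in> \<Omega>" and y: "y \<in> \<Omega>"
    and gap: "\<And>z. z \<in> \<Omega> \<Longrightarrow> (v + (1 / lam) *\<^sub>R (y - x)) \<bullet> (y - z) \<le> \<eta>"
  shows "(norm (gradient_mapping \<Omega> x (D x) lam))\<^sup>2 \<le>
    18 * L * (F x - F y + \<eta> - L * (norm (y - x))\<^sup>2 + (norm (v - D x))\<^sup>2 / (6 * L))"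
proof -
  define p where "p = prox_point \<Omega> x (D x) lam"
  have lam: "lam > 0" "1 / lam = 3 * L" using assms(4,7) by simp_all
  have p: "p \<in> \<Omega>" unfolding p_def by (rule prox_point_in[OF assms(1-3) lam(1)])
  have up: "F y \<le> F x + D x \<bullet> (y - x) + (L / 2) * (norm (y - x))\<^sup>2"
    by (rule descent_upper[OF assms(3) x y assms(5)]) (use assms(6) x in auto)
  have "(D x + (3 * L) *\<^sub>R (p - x)) \<bullet> (p - x) \<le> 0"
    using prox_point_variational[OF assms(1-3) lam(1) x, of "D x" x] unfolding p_def lam(2) by simp
  then have exact: "D x \<bullet> (p - x) \<le> - 3 * L * (norm (p - x))\<^sup>2"
    by (simp add: inner_add_left power2_norm_eq_inner)
  have inexact: "v \<bullet> (y - p) + 3 * L * ((y - x) \<bullet> (y - p)) \<le> \<eta>"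
    using gap[OF p] by (simp add: lam(2) inner_add_left)
  have three_point: "2 * ((y - x) \<bullet> (y - p)) = (norm (y - x))\<^sup>2 + (norm (y - p))\<^sup>2 - (norm (p - x))\<^sup>2"
    by (simp add: power2_norm_eq_inner inner_diff_left inner_diff_right inner_commute)
  \<comment> \<open>The weight is chosen so that the square of \<open>norm (y - p)\<close> cancels
    against the same term in \<open>tp\<close>.\<close>
  have young: "- ((v - D x) \<bullet> (y - p)) \<le> (3 * L / 2) * (norm (y - p))\<^sup>2 + (norm (v - D x))\<^sup>2 / (6 * L)"
  proof -
    define a e where "a = y - p" and "e = v - D x"
    have "0 \<le> (norm ((3 * L) *\<^sub>R a + e))\<^sup>2 / (6 * L)" using assms(4) by simp
    also have "(norm ((3 * L) *\<^sub>R a + e))\<^sup>2 = 9 * L\<^sup>2 * (norm a)\<^sup>2 + 6 * L * (e \<bullet> a) + (norm e)\<^sup>2"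
      unfolding power2_norm_eq_inner
      by (simp add: inner_add_left inner_add_right inner_commute power2_eq_square)
    also have "\<dots> / (6 * L) = (3 * L / 2) * (norm a)\<^sup>2 + (norm e)\<^sup>2 / (6 * L) + e \<bullet> a"
      using assms(4) by (simp add: field_simps power2_eq_square)
    finally show ?thesis unfolding a_def e_def by simp
  qed
  have split1: "D x \<bullet> (y - x) = D x \<bullet> (p - x) + v \<bullet> (y - p) - (v - D x) \<bullet> (y - p)"
    by (simp add: inner_diff_left inner_diff_right)
  have tp: "3 * L * ((y - x) \<bullet> (y - p)) =
      (3 * L / 2) * (norm (y - x))\<^sup>2 + (3 * L / 2) * (norm (y - p))\<^sup>2 - (3 * L / 2) * (norm (p - x))\<^sup>2"
    using arg_cong[OF three_point, of "\<lambda>a. (3 * L / 2) * a"] by (simp add: algebra_simps)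
  \<comment> \<open>The sum of the inequalities has coefficient \<open>- 3 * L / 2\<close> at the
    square of \<open>norm (p - x)\<close>, and \<open>slack\<close> gives \<open>L\<close> of it
    away. This is why the constant is 18 and not 6: 9 L^2 = 18 L (L / 2).\<close>
  have slack: "0 \<le> L * (norm (p - x))\<^sup>2" using assms(4) by simp
  have main: "(L / 2) * (norm (p - x))\<^sup>2 \<le>
      F x - F y + \<eta> - L * (norm (y - x))\<^sup>2 + (norm (v - D x))\<^sup>2 / (6 * L)"
    using up exact inexact tp young split1 slack by linarith
  have "norm (gradient_mapping \<Omega> x (D x) lam) = 3 * L * norm (p - x)"
    unfolding gradient_mapping_def p_def[symmetric] lam(2) using assms(4)
    by (simp add: norm_minus_commute)
  then have "(norm (gradient_mapping \<Omega> x (D x) lam))\<^sup>2 = 18 * L * ((L / 2) * (norm (p - x))\<^sup>2)"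
    by (simp add: power2_eq_square)
  also have "\<dots> \<le> 18 * L *
      (F x - F y + \<eta> - L * (norm (y - x))\<^sup>2 + (norm (v - D x))\<^sup>2 / (6 * L))"
    using main assms(4) by (intro mult_left_mono) auto
  finally show ?thesis .
qed

section \<open>Finite expectations and resampling of a single draw\<close>

lemma expectation_mono_finite:
  fixes g h :: "'b \<Rightarrow> real"
  assumes "finite (set_pmf P)" and "\<And>r. r \<in> set_pmf P \<Longrightarrow> g r \<le> h r"
  shows "measure_pmf.expectation P g \<le> measure_pmf.expectation P h"
  using assms by (intro integral_mono_AE integrable_measure_pmf_finite) (auto simp: AE_measure_pmf_iff)

lemma expectation_pair_pmf_finite:
  fixes h :: "'b \<times> 'c \<Rightarrow> real"
  assumes "finite (set_pmf p)" and "finite (set_pmf q)"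
  shows "measure_pmf.expectation (pair_pmf p q) h =
    measure_pmf.expectation p (\<lambda>x. measure_pmf.expectation q (\<lambda>y. h (x, y)))"
proof -
  have "measure_pmf.expectation (pair_pmf p q) h =
      (\<Sum>x\<in>set_pmf p. pmf p x *\<^sub>R measure_pmf.expectation (map_pmf (Pair x) q) h)"
    unfolding pair_pmf_def map_pmf_def[symmetric]
    using assms by (intro pmf_expectation_bind) auto
  also have "\<dots> = measure_pmf.expectation p (\<lambda>x. measure_pmf.expectation q (\<lambda>y. h (x, y)))"
    using assms(1) by (subst integral_measure_pmf[of "set_pmf p"]) auto
  finally show ?thesis .
qed

text \<open>The fresh value overwrites the old one and is independent of the other coordinates, so
  the law does not change.\<close>

lemma Pi_pmf_resample:
  assumes "finite A" and "a \<in> A"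
  shows "Pi_pmf A d p = bind_pmf (Pi_pmf A d p) (\<lambda>r. map_pmf (\<lambda>i. r(a := i)) (p a))"
proof -
  define B where "B = A - {a}"
  have B: "finite B" "a \<notin> B" "A = insert a B" using assms by (auto simp: B_def)
  have "bind_pmf (Pi_pmf A d p) (\<lambda>r. map_pmf (\<lambda>i. r(a := i)) (p a)) =
      bind_pmf (Pi_pmf B d p) (\<lambda>f. bind_pmf (p a) (\<lambda>i. return_pmf (f(a := i))))"
    unfolding B(3) Pi_pmf_insert'[OF B(1,2)] map_pmf_def
    by (simp add: bind_assoc_pmf bind_return_pmf)
  also have "\<dots> = Pi_pmf A d p"
    unfolding B(3) Pi_pmf_insert'[OF B(1,2)] by (rule bind_commute_pmf)
  finally show ?thesis by simp
qed

lemma finite_set_Pi_pmf_uniform: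
  assumes "finite A" and "finite J" and "J \<noteq> {}"
  shows "finite (set_pmf (Pi_pmf A d (\<lambda>_. pmf_of_set J)))"
  using assms by (subst set_Pi_pmf) (auto intro!: finite_PiE_dflt)

text \<open>Stands in for conditional expectation given all draws but one: the inner average is
  taken pointwise in the table \<open>r\<close>.\<close>

lemma expectation_resample_uniform:
  fixes h :: "('k \<Rightarrow> 'i) \<Rightarrow> real" and d :: 'i
  assumes "finite A" and "a \<in> A" and "finite J" and "J \<noteq> {}"
  defines "P \<equiv> Pi_pmf A d (\<lambda>_. pmf_of_set J)"
  shows "measure_pmf.expectation P h =
    measure_pmf.expectation P (\<lambda>r. (\<Sum>i\<in>J. h (r(a := i))) / card J)"
proof -
  have fin: "finite (set_pmf P)" unfolding P_def by (rule finite_set_Pi_pmf_uniform[OF assms(1,3,4)])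
  have "measure_pmf.expectation P h =
      measure_pmf.expectation (bind_pmf P (\<lambda>r. map_pmf (\<lambda>i. r(a := i)) (pmf_of_set J))) h"
    unfolding P_def by (subst Pi_pmf_resample[OF assms(1,2)]) (rule refl)
  also have "\<dots> = (\<Sum>r\<in>set_pmf P. pmf P r *\<^sub>R
      measure_pmf.expectation (map_pmf (\<lambda>i. r(a := i)) (pmf_of_set J)) h)"
    using assms fin by (intro pmf_expectation_bind) auto
  also have "\<dots> = (\<Sum>r\<in>set_pmf P. pmf P r *\<^sub>R ((\<Sum>i\<in>J. h (r(a := i))) / card J))"
    using assms by (simp add: integral_pmf_of_set)
  also have "\<dots> = measure_pmf.expectation P (\<lambda>r. (\<Sum>i\<in>J. h (r(a := i))) / card J)"
    using fin by (subst integral_measure_pmf[of "set_pmf P"]) auto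
  finally show ?thesis .
qed

text \<open>
  Resampling the coordinate \<open>a k\<close> leaves \<open>Z\<close> and the other sampled terms unchanged, so the mixed
  terms of the expanded square average to zero.
\<close>

lemma minibatch_second_moment:
  fixes Z :: "('k \<Rightarrow> 'i) \<Rightarrow> 'i \<Rightarrow> 'a::real_inner" and d :: 'i
  assumes A: "finite A" and J: "finite J" "J \<noteq> {}"
    and a: "inj_on a {..<b}" "\<And>k. k < b \<Longrightarrow> a k \<in> A"
  defines "P \<equiv> Pi_pmf A d (\<lambda>_. pmf_of_set J)"
  assumes stable: "\<And>r k i. r \<in> set_pmf P \<Longrightarrow> k < b \<Longrightarrow> i \<in> J \<Longrightarrow> Z (r(a k := i)) = Z r"
    and centred: "\<And>r. r \<in> set_pmf P \<Longrightarrow> (\<Sum>i\<in>J. Z r i) = 0"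
  shows "measure_pmf.expectation P (\<lambda>r. (norm (\<Sum>k<b. Z r (r (a k))))\<^sup>2) =
    real b * measure_pmf.expectation P (\<lambda>r. (\<Sum>i\<in>J. (norm (Z r i))\<^sup>2) / card J)"
proof -
  have fin: "finite (set_pmf P)" unfolding P_def by (rule finite_set_Pi_pmf_uniform[OF A J])
  have int: "integrable (measure_pmf P) h" for h :: "_ \<Rightarrow> real"
    by (rule integrable_measure_pmf_finite[OF fin])
  define V where "V = measure_pmf.expectation P (\<lambda>r. (\<Sum>i\<in>J. (norm (Z r i))\<^sup>2) / card J)"
  \<comment> \<open>The summands share the random \<open>Z r\<close> and need not be independent;
    that they are uncorrelated is enough for the square of their sum.\<close>
  have cov: "measure_pmf.expectation P (\<lambda>r. Z r (r (a k)) \<bullet> Z r (r (a l))) = (if k = l then V else 0)"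
    if k: "k < b" and l: "l < b" for k l
  proof -
    have "measure_pmf.expectation P (\<lambda>r. Z r (r (a k)) \<bullet> Z r (r (a l))) =
        measure_pmf.expectation P (\<lambda>r. (\<Sum>i\<in>J. Z (r(a k := i)) ((r(a k := i)) (a k)) \<bullet>
          Z (r(a k := i)) ((r(a k := i)) (a l))) / card J)"
      unfolding P_def by (rule expectation_resample_uniform[OF A a(2)[OF k] J])
    also have "\<dots> = measure_pmf.expectation P (\<lambda>r. if k = l then (\<Sum>i\<in>J. (norm (Z r i))\<^sup>2) / card J else 0)"
    proof (intro integral_cong_AE AE_pmfI)
      fix r assume r: "r \<in> set_pmf P"
      have "(\<Sum>i\<in>J. Z (r(a k := i)) ((r(a k := i)) (a k)) \<bullet> Z (r(a k := i)) ((r(a k := i)) (a l))) =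
          (\<Sum>i\<in>J. Z r i \<bullet> Z r ((r(a k := i)) (a l)))"
        using stable[OF r k] by (intro sum.cong) simp_all
      also have "\<dots> = (if k = l then (\<Sum>i\<in>J. (norm (Z r i))\<^sup>2) else 0)"
      proof (cases "k = l")
        case False
        then have "a l \<noteq> a k" using a(1) k l by (auto dest: inj_onD)
        then have "(\<Sum>i\<in>J. Z r i \<bullet> Z r ((r(a k := i)) (a l))) = (\<Sum>i\<in>J. Z r i) \<bullet> Z r (r (a l))"
          by (simp add: inner_sum_left)
        then show ?thesis using False centred[OF r] by simp
      qed (simp add: power2_norm_eq_inner)
      finally show "(\<Sum>i\<in>J. Z (r(a k := i)) ((r(a k := i)) (a k)) \<bullet>
            Z (r(a k := i)) ((r(a k := i)) (a l))) / card J =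
          (if k = l then (\<Sum>i\<in>J. (norm (Z r i))\<^sup>2) / card J else 0)"
        by simp
    qed simp_all
    also have "\<dots> = (if k = l then V else 0)" by (simp add: V_def)
    finally show ?thesis .
  qed
  have "measure_pmf.expectation P (\<lambda>r. (norm (\<Sum>k<b. Z r (r (a k))))\<^sup>2) =
      (\<Sum>k<b. \<Sum>l<b. measure_pmf.expectation P (\<lambda>r. Z r (r (a l)) \<bullet> Z r (r (a k))))"
    unfolding power2_norm_eq_inner inner_sum_left inner_sum_right
    by (simp add: Bochner_Integration.integral_sum int)
  also have "\<dots> = (\<Sum>k<b. \<Sum>l<b. if k = l then V else 0)"
    by (intro sum.cong) (auto simp: cov)
  also have "\<dots> = real b * V" by simp
  finally show ?thesis by (simp add: V_def)
qed

section \<open>Variance of the stochastic gradient\<close>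

text \<open>Centring lowers the sum of squares by exactly \<open>card J\<close> times the squared
  norm of the mean.\<close>

lemma sum_norm_sq_centred_le:
  fixes c :: "'i \<Rightarrow> 'a::real_inner"
  assumes "finite J"
  shows "(\<Sum>i\<in>J. (norm (c i - (1 / card J) *\<^sub>R (\<Sum>j\<in>J. c j)))\<^sup>2) \<le> (\<Sum>i\<in>J. (norm (c i))\<^sup>2)"
proof (cases "J = {}")
  case False
  define \<mu> where "\<mu> = (1 / card J) *\<^sub>R (\<Sum>j\<in>J. c j)"
  have N: "real (card J) > 0" using False assms by (simp add: card_gt_0_iff)
  have \<mu>: "(\<Sum>j\<in>J. c j) = card J *\<^sub>R \<mu>" using N by (simp add: \<mu>_def)
  have "(\<Sum>i\<in>J. (norm (c i - \<mu>))\<^sup>2) = (\<Sum>i\<in>J. (norm (c i))\<^sup>2 - 2 * (c i \<bullet> \<mu>) + \<mu> \<bullet> \<mu>)"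
    by (intro sum.cong) (auto simp: power2_norm_eq_inner inner_diff_left inner_diff_right inner_commute)
  also have "\<dots> = (\<Sum>i\<in>J. (norm (c i))\<^sup>2) - card J * (\<mu> \<bullet> \<mu>)"
    by (simp add: sum.distrib sum_subtractf flip: sum_distrib_left inner_sum_left) (simp add: \<mu>)
  finally show ?thesis by (simp add: \<mu>_def)
qed simp

text \<open>The triangle inequality on the telescoping sum, then Cauchy-Schwarz against the constant
  sequence 1.\<close>

lemma norm_sq_diff_le_sum_steps:
  fixes x :: "nat \<Rightarrow> 'a::real_normed_vector"
  shows "(norm (x t - x 0))\<^sup>2 \<le> real t * (\<Sum>j<t. (norm (x (Suc j) - x j))\<^sup>2)"
proof -
  have "norm (x t - x 0) \<le> (\<Sum>j<t. norm (x (Suc j) - x j))"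
    unfolding sum_lessThan_telescope[symmetric] by (rule norm_sum)
  then have "(norm (x t - x 0))\<^sup>2 \<le> (\<Sum>j<t. 1 * norm (x (Suc j) - x j))\<^sup>2"
    by (simp add: power_mono)
  also have "\<dots> \<le> (\<Sum>j<t. 1\<^sup>2) * (\<Sum>j<t. (norm (x (Suc j) - x j))\<^sup>2)"
    by (rule Cauchy_Schwarz_ineq_sum)
  finally show ?thesis by simp
qed

text \<open>The full snapshot gradient cancels, so the error is an average of \<open>b\<close>
  centred gradient differences. The factor 1 / \<open>b\<close> comes from their vanishing mixed
  terms, \<open>L\<^sup>2\<close> from smoothness. The premise \<open>stable\<close> expresses that
  \<open>x\<close> and \<open>y\<close> do not depend on the minibatch being drawn.\<close>

lemma svrg_direction_variance:
  fixes f :: "nat \<Rightarrow> 'a::euclidean_space \<Rightarrow> real" and x y :: "_ \<Rightarrow> 'a" and n S m b :: nat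
  assumes n: "n \<ge> 1" and b: "b \<ge> 1" and s: "s < S" and t: "t < m"
    and smooth: "\<And>i. i \<in> {1..n} \<Longrightarrow> L_smooth_on L \<Omega> (f i)"
  defines "P \<equiv> index_draws n S m b"
  assumes in_\<Omega>: "\<And>r. r \<in> set_pmf P \<Longrightarrow> x r \<in> \<Omega> \<and> y r \<in> \<Omega>"
    and stable: "\<And>r k i. r \<in> set_pmf P \<Longrightarrow> k < b \<Longrightarrow> i \<in> {1..n} \<Longrightarrow>
      x (r((s, t, k) := i)) = x r \<and> y (r((s, t, k) := i)) = y r"
  shows "measure_pmf.expectation P (\<lambda>r. (norm (svrg_direction f n b (\<lambda>k. r (s, t, k)) (x r) (y r)
        - (1 / real n) *\<^sub>R (\<Sum>i=1..n. gradient (f i) (x r))))\<^sup>2)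
      \<le> L\<^sup>2 / real b * measure_pmf.expectation P (\<lambda>r. (norm (x r - y r))\<^sup>2)"
proof -
  let ?A = "{..<S} \<times> {..<m} \<times> {..<b}" and ?J = "{1..n}"
  have P: "P = Pi_pmf ?A 0 (\<lambda>_. pmf_of_set ?J)" by (simp add: P_def index_draws_def)
  have J: "finite ?J" "?J \<noteq> {}" using n by auto
  have fin: "finite (set_pmf P)" unfolding P by (rule finite_set_Pi_pmf_uniform) (use J in auto)
  define c where "c r i = gradient (f i) (x r) - gradient (f i) (y r)" for r i
  define Z where "Z r i = c r i - (1 / card ?J) *\<^sub>R (\<Sum>j\<in>?J. c r j)" for r i
  have err: "svrg_direction f n b (\<lambda>k. r (s, t, k)) (x r) (y r)
        - (1 / real n) *\<^sub>R (\<Sum>i=1..n. gradient (f i) (x r)) = (1 / real b) *\<^sub>R (\<Sum>k<b. Z r (r (s, t, k)))" for r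
    using b by (simp add: svrg_direction_def Z_def c_def sum_subtractf scaleR_diff_right
        sum_constant_scaleR)
  have "measure_pmf.expectation P (\<lambda>r. (norm (\<Sum>k<b. Z r (r (s, t, k))))\<^sup>2) =
      real b * measure_pmf.expectation P (\<lambda>r. (\<Sum>i\<in>?J. (norm (Z r i))\<^sup>2) / card ?J)"
    unfolding P
  proof (rule minibatch_second_moment[OF _ J, where a = "\<lambda>k. (s, t, k)"])
    show "Z (r((s, t, k) := i)) = Z r" if "r \<in> set_pmf (Pi_pmf ?A 0 (\<lambda>_. pmf_of_set ?J))" "k < b" "i \<in> ?J" for r k i
      using stable[folded P] that unfolding P Z_def c_def by auto
    show "(\<Sum>i\<in>?J. Z r i) = 0" for r
      using n by (simp add: Z_def sum_subtractf sum_constant_scaleR)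
  qed (use s t in \<open>auto intro: inj_onI\<close>)
  also have "\<dots> \<le> real b * measure_pmf.expectation P (\<lambda>r. L\<^sup>2 * (norm (x r - y r))\<^sup>2)"
  proof (intro mult_left_mono expectation_mono_finite fin)
    fix r assume "r \<in> set_pmf P"
    then have in\<Omega>: "x r \<in> \<Omega>" "y r \<in> \<Omega>" using in_\<Omega> by auto
    have "(\<Sum>i\<in>?J. (norm (Z r i))\<^sup>2) \<le> (\<Sum>i\<in>?J. (norm (c r i))\<^sup>2)"
      unfolding Z_def by (rule sum_norm_sq_centred_le) simp
    also have "\<dots> \<le> (\<Sum>i\<in>?J. (L * norm (x r - y r))\<^sup>2)"
      using smooth in\<Omega> unfolding L_smooth_on_def c_def by (intro sum_mono power_mono) auto
    finally show "(\<Sum>i\<in>?J. (norm (Z r i))\<^sup>2) / card ?J \<le> L\<^sup>2 * (norm (x r - y r))\<^sup>2"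
      using n by (simp add: field_simps power_mult_distrib)
  qed simp
  finally have "measure_pmf.expectation P (\<lambda>r. (norm (\<Sum>k<b. Z r (r (s, t, k))))\<^sup>2) / (real b)\<^sup>2
      \<le> real b * (L\<^sup>2 * measure_pmf.expectation P (\<lambda>r. (norm (x r - y r))\<^sup>2)) / (real b)\<^sup>2"
    by (intro divide_right_mono) simp_all
  then show ?thesis
    unfolding err using b by (simp add: power_mult_distrib power_divide power2_eq_square)
qed

section \<open>The convergence bound\<close>

theorem theorem3:
  fixes \<Omega> :: "'a::euclidean_space set"
    and f :: "nat \<Rightarrow> 'a \<Rightarrow> real"
    and n m b T :: nat
    and L lam \<eta> :: real
    and \<theta>\<^sub>0 \<theta>star :: 'a
    and \<theta> :: "(nat \<times> nat \<times> nat \<Rightarrow> nat) \<Rightarrow> nat \<Rightarrow> nat \<Rightarrow> 'a"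
  assumes "\<Omega> \<noteq> {}" and "compact \<Omega>" and "convex \<Omega>"
    and "n \<ge> 1"
    and "L > 0"
    and "\<And>i x. i \<in> {1..n} \<Longrightarrow> x \<in> \<Omega> \<Longrightarrow> f i differentiable (at x)"
    and "\<And>i. i \<in> {1..n} \<Longrightarrow> L_smooth_on L \<Omega> (f i)"
    and "\<theta>\<^sub>0 \<in> \<Omega>"
    and "is_arg_min (avg_fun n f) (\<lambda>x. x \<in> \<Omega>) \<theta>star"
    and "real b = real n powr (2 / 3)"
    and "real m = real n powr (1 / 3)"
    and "lam = 1 / (3 * L)"
    and "T > 0" and "m dvd T"
    and "\<eta> = 1 / real T"
    and "ncgs_vr \<Omega> f n m lam \<eta> b T \<theta>\<^sub>0 \<theta>"
  shows "measure_pmf.expectation (ncgs_vr_output n m b T \<theta>)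
           (\<lambda>x. (norm (gradient_mapping \<Omega> x (gradient (avg_fun n f) x) lam))\<^sup>2)
         \<le> 18 * L * (avg_fun n f \<theta>\<^sub>0 - avg_fun n f \<theta>star + 1) / real T"
proof -
  define F where "F = avg_fun n f"
  \<comment> \<open>An explicit average, which inherits the Lipschitz bound by the triangle
    inequality; \<open>GDERIV_gradient\<close> identifies it with \<open>gradient F\<close> on
    \<open>\<Omega>\<close>.\<close>
  define D where "D z = (1 / real n) *\<^sub>R (\<Sum>i=1..n. gradient (f i) z)" for z
  define S where "S = T div m"
  define P where "P = index_draws n S m b"
  define E :: "(_ \<Rightarrow> real) \<Rightarrow> real" where "E = measure_pmf.expectation P"
  note compact = \<open>compact \<Omega>\<close> and convex = \<open>convex \<Omega>\<close> and L = \<open>L > 0\<close>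
  note smooth = \<open>\<And>i. i \<in> {1..n} \<Longrightarrow> L_smooth_on L \<Omega> (f i)\<close>

  have "real m > 0" using \<open>n \<ge> 1\<close> \<open>real m = _\<close> by simp
  then have m: "m > 0" by simp
  \<comment> \<open>This relation between batch size and epoch length later cancels the loss from
    summing the errors of an epoch.\<close>
  have "real b = (real m)\<^sup>2"
    using \<open>real b = _\<close> \<open>real m = _\<close> by (simp add: power2_eq_square powr_add[symmetric])
  then have bm: "b = m\<^sup>2" by (simp flip: of_nat_power)
  then have b: "b \<ge> 1" using m by simp
  have T: "T = S * m" using \<open>m dvd T\<close> by (simp add: S_def)
  have S: "S > 0" using \<open>T > 0\<close> T by (cases S) auto
  have lam: "lam > 0" and \<eta>: "\<eta> > 0" using \<open>lam = _\<close> \<open>\<eta> = _\<close> L \<open>T > 0\<close> by simp_all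

  have deriv: "GDERIV F z :> D z" if "z \<in> \<Omega>" for z
    unfolding F_def D_def using \<open>\<And>i x. i \<in> {1..n} \<Longrightarrow> x \<in> \<Omega> \<Longrightarrow> f i differentiable (at x)\<close> that
    by (intro GDERIV_avg_fun)
  have lipschitz: "norm (D y - D z) \<le> L * norm (y - z)" if "y \<in> \<Omega>" "z \<in> \<Omega>" for y z
  proof -
    have "norm (D y - D z) = (1 / real n) * norm (\<Sum>i=1..n. gradient (f i) y - gradient (f i) z)"
      by (simp add: D_def sum_subtractf flip: scaleR_diff_right)
    also have "\<dots> \<le> (1 / real n) * (\<Sum>i=1..n. L * norm (y - z))"
      using smooth that unfolding L_smooth_on_def by (intro mult_left_mono sum_norm_le) auto
    also have "\<dots> = L * norm (y - z)" using \<open>n \<ge> 1\<close> by simp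
    finally show ?thesis .
  qed

  have fin: "finite (set_pmf P)"
    unfolding P_def index_draws_def by (rule finite_set_Pi_pmf_uniform) (use \<open>n \<ge> 1\<close> in auto)
  have int: "integrable (measure_pmf P) h" for h :: "_ \<Rightarrow> real"
    by (rule integrable_measure_pmf_finite[OF fin])
  have E_mono: "E g \<le> E h" if "\<And>r. r \<in> set_pmf P \<Longrightarrow> g r \<le> h r" for g h
    unfolding E_def by (rule expectation_mono_finite[OF fin that])

  note run = \<open>ncgs_vr \<Omega> f n m lam \<eta> b T \<theta>\<^sub>0 \<theta>\<close>[unfolded ncgs_vr_def Let_def, folded S_def, folded P_def]
  have init: "\<theta> r 0 m = \<theta>\<^sub>0" if "r \<in> set_pmf P" for r
    using run that by blast
  have epoch: "\<theta> r (Suc s) 0 = \<theta> r s m" if "r \<in> set_pmf P" "s < S" for r s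
    using run that unfolding Suc_eq_plus1 by blast
  define v where "v r s t = svrg_direction f n b (\<lambda>k. r (s, t, k)) (\<theta> r (Suc s) t) (\<theta> r s m)" for r s t
  have step: "condg \<Omega> (v r s t) (\<theta> r (Suc s) t) lam \<eta> (\<theta> r (Suc s) (Suc t))"
    if "r \<in> set_pmf P" "s < S" "t < m" for r s t
    using run that unfolding v_def Suc_eq_plus1 by blast
  have adapted: "\<theta> r (Suc s) t = \<theta> r' (Suc s) t"
    if "r \<in> set_pmf P" "r' \<in> set_pmf P" "s < S" "t \<le> m"
      "\<And>s' t' k. s' < s \<or> s' = s \<and> t' < t \<Longrightarrow> r (s', t', k) = r' (s', t', k)" for r r' s t
    using run that unfolding Suc_eq_plus1 by blast

  \<comment> \<open>Each snapshot is the last iterate of the previous epoch, so feasibility needs an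
    inner induction over steps and an outer one over epochs.\<close>
  have in_epoch: "\<theta> r (Suc s) t \<in> \<Omega>"
    if "r \<in> set_pmf P" "s < S" "\<theta> r s m \<in> \<Omega>" "t \<le> m" for r s t
    using that(4)
  proof (induction t)
    case 0
    then show ?case using epoch that by simp
  next
    case (Suc t)
    then show ?case
      using condg_in[OF compact convex _ lam \<eta> step[OF that(1,2)]] by simp
  qed
  have in_snapshot: "\<theta> r s m \<in> \<Omega>" if "r \<in> set_pmf P" "s \<le> S" for r s
    using that(2)
  proof (induction s)
    case 0
    then show ?case using init[OF that(1)] \<open>\<theta>\<^sub>0 \<in> \<Omega>\<close> by simp
  next
    case (Suc s)
    then show ?case using in_epoch[OF that(1)] by simp
  qed
  have in_\<Omega>: "\<theta> r (Suc s) t \<in> \<Omega>" if "r \<in> set_pmf P" "s < S" "t \<le> m" for r s t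
    using in_epoch in_snapshot that by simp

  define G where "G x = (norm (gradient_mapping \<Omega> x (D x) lam))\<^sup>2" for x
  define d where "d s t r = (norm (\<theta> r (Suc s) (Suc t) - \<theta> r (Suc s) t))\<^sup>2" for s t r
  define e where "e s t r = (norm (v r s t - D (\<theta> r (Suc s) t)))\<^sup>2" for s t r

  have G_step: "G (\<theta> r (Suc s) t) \<le>
      18 * L * (F (\<theta> r (Suc s) t) - F (\<theta> r (Suc s) (Suc t)) + \<eta> - L * d s t r + e s t r / (6 * L))"
    if "r \<in> set_pmf P" "s < S" "t < m" for r s t
    unfolding G_def d_def e_def
    using in_\<Omega> that condg_gap[OF compact convex _ lam \<eta> step[OF that]]
    by (intro inexact_prox_descent[OF \<open>\<Omega> \<noteq> {}\<close> compact convex L deriv lipschitz \<open>lam = _\<close>]) auto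

  \<comment> \<open>Expected gradient error over one epoch\<close>
  have variance: "E (e s t) \<le> L\<^sup>2 / real b * E (\<lambda>r. (norm (\<theta> r (Suc s) t - \<theta> r (Suc s) 0))\<^sup>2)"
    if s: "s < S" and t: "t < m" for s t
  proof -
    \<comment> \<open>The snapshot \<open>\<theta> r s m\<close> is rewritten as the first iterate
      of the same epoch, so that \<open>adapted\<close> covers both points.\<close>
    have "E (e s t) = E (\<lambda>r. (norm (svrg_direction f n b (\<lambda>k. r (s, t, k)) (\<theta> r (Suc s) t) (\<theta> r (Suc s) 0)
        - (1 / real n) *\<^sub>R (\<Sum>i=1..n. gradient (f i) (\<theta> r (Suc s) t))))\<^sup>2)"
      unfolding E_def e_def v_def D_def
      by (intro integral_cong_AE AE_pmfI) (use epoch s in auto)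
    also have "\<dots> \<le> L\<^sup>2 / real b * E (\<lambda>r. (norm (\<theta> r (Suc s) t - \<theta> r (Suc s) 0))\<^sup>2)"
      unfolding E_def P_def
    proof (rule svrg_direction_variance[OF \<open>n \<ge> 1\<close> b s t smooth], unfold P_def[symmetric])
      fix r assume r: "r \<in> set_pmf P"
      then show "\<theta> r (Suc s) t \<in> \<Omega> \<and> \<theta> r (Suc s) 0 \<in> \<Omega>" using in_\<Omega> s t by simp
      fix k i assume "k < b" and i: "i \<in> {1..n}"
      \<comment> \<open>The altered table must stay in the support, since only there do the
        assumptions constrain \<open>\<theta>\<close>.\<close>
      then have r': "r((s, t, k) := i) \<in> set_pmf P"
        using r s t unfolding P_def index_draws_def
        by (auto simp: set_Pi_pmf PiE_dflt_def)
      \<comment> \<open>The altered entry belongs to the draws of step \<open>t\<close>, which are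
        made only after iterate \<open>t\<close> is formed.\<close>
      show "\<theta> (r((s, t, k) := i)) (Suc s) t = \<theta> r (Suc s) t \<and>
          \<theta> (r((s, t, k) := i)) (Suc s) 0 = \<theta> r (Suc s) 0"
        by (intro conjI adapted[OF r' r s]) (use t in auto)
    qed
    finally show ?thesis .
  qed

  have error_sum: "(\<Sum>t<m. E (e s t)) \<le> L\<^sup>2 * (\<Sum>t<m. E (d s t))" if s: "s < S" for s
  proof -
    have "E (e s t) \<le> L\<^sup>2 / real b * (real m * (\<Sum>j<m. E (d s j)))" if t: "t < m" for t
    proof -
      have "(norm (\<theta> r (Suc s) t - \<theta> r (Suc s) 0))\<^sup>2 \<le> real m * (\<Sum>j<m. d s j r)" for r
      proof -
        have "(norm (\<theta> r (Suc s) t - \<theta> r (Suc s) 0))\<^sup>2 \<le> real t * (\<Sum>j<t. d s j r)"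
          unfolding d_def by (rule norm_sq_diff_le_sum_steps)
        also have "\<dots> \<le> real m * (\<Sum>j<m. d s j r)"
          using t by (intro mult_mono sum_mono2 sum_nonneg) (auto simp: d_def)
        finally show ?thesis .
      qed
      then have "E (\<lambda>r. (norm (\<theta> r (Suc s) t - \<theta> r (Suc s) 0))\<^sup>2) \<le> E (\<lambda>r. real m * (\<Sum>j<m. d s j r))"
        by (rule E_mono)
      also have "\<dots> = real m * (\<Sum>j<m. E (d s j))"
        unfolding E_def by (simp add: int Bochner_Integration.integral_sum)
      finally have "L\<^sup>2 / real b * E (\<lambda>r. (norm (\<theta> r (Suc s) t - \<theta> r (Suc s) 0))\<^sup>2) \<le>
          L\<^sup>2 / real b * (real m * (\<Sum>j<m. E (d s j)))"
        by (intro mult_left_mono) auto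
      with variance[OF s t] show ?thesis by linarith
    qed
    then have "(\<Sum>t<m. E (e s t)) \<le> (\<Sum>t<m. L\<^sup>2 / real b * (real m * (\<Sum>j<m. E (d s j))))"
      by (intro sum_mono) auto
    \<comment> \<open>Summing \<open>m\<close> equal bounds, each with a factor
      \<open>m / b\<close>, gives \<open>m\<^sup>2 / b = 1\<close>.\<close>
    also have "\<dots> = L\<^sup>2 * (\<Sum>t<m. E (d s t))"
      using m by (simp add: bm power2_eq_square)
    finally show ?thesis .
  qed

  \<comment> \<open>Telescoping over steps and epochs\<close>
  have epoch_bound: "(\<Sum>t<m. E (\<lambda>r. G (\<theta> r (Suc s) t))) \<le>
      18 * L * (E (\<lambda>r. F (\<theta> r s m)) - E (\<lambda>r. F (\<theta> r (Suc s) m)) + real m * \<eta>)"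
    if s: "s < S" for s
  proof -
    define a where "a t = E (\<lambda>r. F (\<theta> r (Suc s) t))" for t
    have "E (\<lambda>r. G (\<theta> r (Suc s) t)) \<le>
        18 * L * (a t - a (Suc t) + \<eta> - L * E (d s t) + E (e s t) / (6 * L))" if t: "t < m" for t
    proof -
      have "E (\<lambda>r. G (\<theta> r (Suc s) t)) \<le> E (\<lambda>r. 18 * L *
          (F (\<theta> r (Suc s) t) - F (\<theta> r (Suc s) (Suc t)) + \<eta> - L * d s t r + e s t r / (6 * L)))"
        by (intro E_mono G_step s t)
      also have "\<dots> = 18 * L * (a t - a (Suc t) + \<eta> - L * E (d s t) + E (e s t) / (6 * L))"
        unfolding E_def a_def by (simp add: int)
      finally show ?thesis .
    qed
    then have "(\<Sum>t<m. E (\<lambda>r. G (\<theta> r (Suc s) t))) \<le>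
        (\<Sum>t<m. 18 * L * (a t - a (Suc t) + \<eta> - L * E (d s t) + E (e s t) / (6 * L)))"
      by (intro sum_mono) auto
    also have "\<dots> = 18 * L * (a 0 - a m + real m * \<eta> - L * (\<Sum>t<m. E (d s t)) + (\<Sum>t<m. E (e s t)) / (6 * L))"
      unfolding sum_distrib_left[symmetric] sum.distrib sum_subtractf sum_divide_distrib[symmetric]
        sum_lessThan_telescope'[symmetric] by simp
    \<comment> \<open>By \<open>error_sum\<close> and the factor \<open>1 / (6 * L)\<close>, the
      errors consume at most a sixth of the negative term.\<close>
    also have "\<dots> \<le> 18 * L * (a 0 - a m + real m * \<eta>)"
    proof -
      have d_nonneg: "0 \<le> (\<Sum>t<m. E (d s t))"
        unfolding E_def d_def by (intro sum_nonneg) simp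
      have "(\<Sum>t<m. E (e s t)) / (6 * L) \<le> L\<^sup>2 * (\<Sum>t<m. E (d s t)) / (6 * L)"
        using error_sum[OF s] L by (intro divide_right_mono) auto
      also have "\<dots> = L * (\<Sum>t<m. E (d s t)) / 6" using L by (simp add: power2_eq_square)
      also have "\<dots> \<le> L * (\<Sum>t<m. E (d s t))" using d_nonneg L by simp
      finally show ?thesis using L by (intro mult_left_mono) auto
    qed
    \<comment> \<open>An epoch starts where the previous one ended, so the bounds of successive
      epochs chain.\<close>
    also have "a 0 = E (\<lambda>r. F (\<theta> r s m))"
      unfolding a_def E_def by (intro integral_cong_AE AE_pmfI) (use epoch s in auto)
    finally show ?thesis by (simp add: a_def)
  qed

  have total: "(\<Sum>s<S. \<Sum>t<m. E (\<lambda>r. G (\<theta> r (Suc s) t))) \<le> 18 * L * (F \<theta>\<^sub>0 - F \<theta>star + 1)"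
  proof -
    have "(\<Sum>s<S. \<Sum>t<m. E (\<lambda>r. G (\<theta> r (Suc s) t))) \<le>
        (\<Sum>s<S. 18 * L * (E (\<lambda>r. F (\<theta> r s m)) - E (\<lambda>r. F (\<theta> r (Suc s) m)) + real m * \<eta>))"
      by (intro sum_mono epoch_bound) auto
    also have "\<dots> = 18 * L * (E (\<lambda>r. F (\<theta> r 0 m)) - E (\<lambda>r. F (\<theta> r S m)) + real S * (real m * \<eta>))"
      unfolding sum_distrib_left[symmetric] sum.distrib
        sum_lessThan_telescope'[of "\<lambda>s. E (\<lambda>r. F (\<theta> r s m))"] by simp
    \<comment> \<open>The \<open>T\<close> conditional gradient calls lose
      \<open>\<eta> = 1 / real T\<close> each; this is the summand 1 in the final bound.\<close>
    also have "real S * (real m * \<eta>) = 1"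
      using \<open>\<eta> = _\<close> \<open>T > 0\<close> by (simp add: T)
    also have "18 * L * (E (\<lambda>r. F (\<theta> r 0 m)) - E (\<lambda>r. F (\<theta> r S m)) + 1) \<le>
        18 * L * (F \<theta>\<^sub>0 - F \<theta>star + 1)"
    proof -
      have "E (\<lambda>r. F (\<theta> r 0 m)) \<le> E (\<lambda>r. F \<theta>\<^sub>0)" by (intro E_mono) (simp add: init)
      moreover have "E (\<lambda>r. F \<theta>star) \<le> E (\<lambda>r. F (\<theta> r S m))"
        using \<open>is_arg_min _ _ _\<close> in_snapshot by (intro E_mono) (auto simp: is_arg_min_linorder F_def)
      ultimately show ?thesis using L by (intro mult_left_mono) (auto simp: E_def)
    qed
    finally show ?thesis .
  qed

  \<comment> \<open>The random output\<close>
  have "measure_pmf.expectation (ncgs_vr_output n m b T \<theta>)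
      (\<lambda>x. (norm (gradient_mapping \<Omega> x (gradient (avg_fun n f) x) lam))\<^sup>2) =
    E (\<lambda>r. measure_pmf.expectation (pmf_of_set ({..<S} \<times> {..<m}))
      (\<lambda>(s, t). (norm (gradient_mapping \<Omega> (\<theta> r (s + 1) t) (gradient F (\<theta> r (s + 1) t)) lam))\<^sup>2))"
    unfolding ncgs_vr_output_def S_def[symmetric] P_def[symmetric] F_def[symmetric] E_def
    using fin S m by (subst integral_map_pmf, subst expectation_pair_pmf_finite)
      (auto simp: case_prod_beta' lessThan_empty_iff)
  \<comment> \<open>The uniform choice averages over all \<open>S * m = T\<close> iterates, which
    lie in \<open>\<Omega>\<close>, where \<open>gradient F\<close> equals \<open>D\<close>.\<close>
  also have "\<dots> = E (\<lambda>r. (\<Sum>s<S. \<Sum>t<m. G (\<theta> r (Suc s) t)) / real T)"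
    unfolding E_def
  proof (intro integral_cong_AE AE_pmfI)
    fix r assume r: "r \<in> set_pmf P"
    have "measure_pmf.expectation (pmf_of_set ({..<S} \<times> {..<m}))
        (\<lambda>(s, t). (norm (gradient_mapping \<Omega> (\<theta> r (s + 1) t) (gradient F (\<theta> r (s + 1) t)) lam))\<^sup>2) =
      (\<Sum>s<S. \<Sum>t<m. (norm (gradient_mapping \<Omega> (\<theta> r (s + 1) t) (gradient F (\<theta> r (s + 1) t)) lam))\<^sup>2) / real T"
      using S m by (subst integral_pmf_of_set) (auto simp: T sum.cartesian_product lessThan_empty_iff)
    also have "\<dots> = (\<Sum>s<S. \<Sum>t<m. G (\<theta> r (Suc s) t)) / real T"
      using in_\<Omega>[OF r] GDERIV_gradient[OF deriv] by (simp add: G_def)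
    finally show "measure_pmf.expectation (pmf_of_set ({..<S} \<times> {..<m}))
        (\<lambda>(s, t). (norm (gradient_mapping \<Omega> (\<theta> r (s + 1) t) (gradient F (\<theta> r (s + 1) t)) lam))\<^sup>2) =
      (\<Sum>s<S. \<Sum>t<m. G (\<theta> r (Suc s) t)) / real T" .
  qed simp_all
  also have "\<dots> = (\<Sum>s<S. \<Sum>t<m. E (\<lambda>r. G (\<theta> r (Suc s) t))) / real T"
    unfolding E_def by (simp add: int Bochner_Integration.integral_sum)
  also have "\<dots> \<le> 18 * L * (F \<theta>\<^sub>0 - F \<theta>star + 1) / real T"
    using total by (intro divide_right_mono) auto
  finally show ?thesis by (simp add: F_def)
qed

end
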